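(* For any $n,n'\ge0$ and any symmetric functions $F\in\Lambda_n$ and $G\in\Lambda_{n'}$, $$\mathscr{S}_{F\circ G}(m)=\mathscr{S}_F(\mathscr{S}_G(m)),$$ where $F\circ G$ is the plethysm.
   Context: $\Lambda_n$ is the $\mathbb{Q}$-vector space of homogeneous symmetric functions of degree $n$ in variables $x_1,x_2,\dots$ with rational coefficients, with basis the power sum products $\mathsf{p}_\lambda=\prod_i\mathsf{p}_{\lambda_i}$, $\lambda\vdash n$, where $\mathsf{p}_r=\sum_i x_i^r$; $\Lambda=\prod_{n\ge0}\Lambda_n$, $\Lambda_0=\mathbb{Q}$. For $F=\sum_{\lambda\vdash n}c_\lambda\mathsf{p}_\lambda\in\Lambda_n$, the characteristic polynomial is $\mathscr{S}_F(m)=\sum_{\lambda\vdash n}c_\lambda m^{\ell(\lambda)}\in\mathbb{Q}[m]$, where $\ell(\lambda)$ is the length of $\lambda$. Plethysm is determined by: $\mathsf{p}_r\circ G=G(x_1^r,x_2^r,\dots)$ for $r\ge1$, and $F\mapsto F\circ G$ is a $\mathbb{Q}$-algebra homomorphism for fixed $G$. *)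

theory Defs
  imports "HOL-Library.Poly_Mapping" "HOL-Library.Multiset" "HOL-Computational_Algebra.Polynomial"
begin

text \<open>Formal power series over the rationals in countably many commuting variables. A monomial
  is a finitely supported exponent vector; index \<open>i\<close> stands for the variable \<open>x\<^sub>i\<^sub>+\<^sub>1\<close>.\<close>

type_synonym monomial = "nat \<Rightarrow>\<^sub>0 nat"

typedef mseries = "UNIV :: (monomial \<Rightarrow> rat) set"
  morphisms mcoeff MSeries by simp

setup_lifting type_definition_mseries

lemma mseries_eqI: "(\<And>m. mcoeff F m = mcoeff G m) \<Longrightarrow> F = G"
  by (metis ext mcoeff_inject)

lemma finite_monomial_splits: "finite {(a, b). a + b = (m :: monomial)}"
proof -
  let ?A = "{a :: monomial. \<forall>i. Poly_Mapping.lookup a i \<le> Poly_Mapping.lookup m i}"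
  let ?N = "Max (insert 0 (Poly_Mapping.lookup m ` Poly_Mapping.keys m))"
  let ?B = "{f :: nat \<Rightarrow> nat. \<forall>i. (i \<in> Poly_Mapping.keys m \<longrightarrow> f i \<in> {..?N}) \<and>
    (i \<notin> Poly_Mapping.keys m \<longrightarrow> f i = 0)}"
  have "Poly_Mapping.lookup ` ?A \<subseteq> ?B"
  proof clarify
    fix a :: monomial and i
    assume le: "\<forall>i. Poly_Mapping.lookup a i \<le> Poly_Mapping.lookup m i"
    have "Poly_Mapping.lookup m i \<le> ?N" if "i \<in> Poly_Mapping.keys m" using that by simp
    with le show "(i \<in> Poly_Mapping.keys m \<longrightarrow> Poly_Mapping.lookup a i \<in> {..?N}) \<and>
      (i \<notin> Poly_Mapping.keys m \<longrightarrow> Poly_Mapping.lookup a i = 0)"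
      by (metis atMost_iff Poly_Mapping.in_keys_iff le_trans le_zero_eq)
  qed
  moreover have "finite ?B" by (rule finite_set_of_finite_funs) auto
  ultimately have "finite (Poly_Mapping.lookup ` ?A)" by (rule finite_subset)
  then have "finite ?A"
    by (rule finite_imageD) (auto intro: inj_onI poly_mapping_eqI)
  moreover have "{(a, b). a + b = m} \<subseteq> (\<lambda>a. (a, m - a)) ` ?A"
    by (auto simp: Poly_Mapping.lookup_add)
  ultimately show ?thesis by (meson finite_imageI finite_subset)
qed

instantiation mseries :: comm_ring_1
begin

lift_definition zero_mseries :: mseries is "\<lambda>_. 0" .
lift_definition one_mseries :: mseries is "\<lambda>m. if m = 0 then 1 else 0" .
lift_definition plus_mseries :: "mseries \<Rightarrow> mseries \<Rightarrow> mseries" is "\<lambda>F G m. F m + G m" .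
lift_definition minus_mseries :: "mseries \<Rightarrow> mseries \<Rightarrow> mseries" is "\<lambda>F G m. F m - G m" .
lift_definition uminus_mseries :: "mseries \<Rightarrow> mseries" is "\<lambda>F m. - F m" .
lift_definition times_mseries :: "mseries \<Rightarrow> mseries \<Rightarrow> mseries"
  is "\<lambda>F G m. \<Sum>(a, b) | a + b = m. F a * G b" .

instance
proof
  fix F G H :: mseries
  show "F * G * H = F * (G * H)"
  proof (rule mseries_eqI)
    fix m
    let ?S = "\<lambda>m :: monomial. {(a, b). a + b = m}"
    have "mcoeff (F * G * H) m =
      (\<Sum>(d, c)\<in>?S m. \<Sum>(a, b)\<in>?S d. mcoeff F a * mcoeff G b * mcoeff H c)"
      by (simp add: times_mseries.rep_eq sum_distrib_right case_prod_unfold)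
    also have "\<dots> = (\<Sum>x\<in>Sigma (?S m) (\<lambda>(d, c). ?S d).
        mcoeff F (fst (snd x)) * mcoeff G (snd (snd x)) * mcoeff H (snd (fst x)))"
      using finite_monomial_splits[unfolded case_prod_unfold]
      by (simp add: sum.Sigma case_prod_unfold)
    also have "\<dots> = (\<Sum>x\<in>Sigma (?S m) (\<lambda>(a, e). ?S e).
        mcoeff F (fst (fst x)) * (mcoeff G (fst (snd x)) * mcoeff H (snd (snd x))))"
      by (rule sum.reindex_bij_witness[where
            i = "\<lambda>((a, e), (b, c)). ((a + b, c), (a, b))" and
            j = "\<lambda>((d, c), (a, b)). ((a, b + c), (b, c))"])
        (auto simp: ac_simps)
    also have "\<dots> =
      (\<Sum>(a, e)\<in>?S m. \<Sum>(b, c)\<in>?S e. mcoeff F a * (mcoeff G b * mcoeff H c))"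
      using finite_monomial_splits[unfolded case_prod_unfold]
      by (simp add: sum.Sigma case_prod_unfold)
    also have "\<dots> = mcoeff (F * (G * H)) m"
      by (simp add: times_mseries.rep_eq sum_distrib_left case_prod_unfold)
    finally show "mcoeff (F * G * H) m = mcoeff (F * (G * H)) m" .
  qed
  show "F * G = G * F"
  proof (rule mseries_eqI)
    fix m
    show "mcoeff (F * G) m = mcoeff (G * F) m"
      unfolding times_mseries.rep_eq
      by (rule sum.reindex_bij_witness[where i = prod.swap and j = prod.swap])
        (auto simp: ac_simps)
  qed
  show "1 * F = F"
  proof (rule mseries_eqI)
    fix m
    have "mcoeff (1 * F) m = (\<Sum>(a, b)\<in>{(0, m)}. mcoeff 1 a * mcoeff F b)"
      unfolding times_mseries.rep_eq
      by (rule sum.mono_neutral_right)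
        (auto simp: finite_monomial_splits one_mseries.rep_eq split: if_splits)
    then show "mcoeff (1 * F) m = mcoeff F m" by (simp add: one_mseries.rep_eq)
  qed
  show "(F + G) * H = F * H + G * H"
    by (rule mseries_eqI)
      (simp add: times_mseries.rep_eq plus_mseries.rep_eq distrib_right case_prod_unfold
        sum.distrib)
  show "F + G + H = F + (G + H)" "F + G = G + F" "0 + F = F" "- F + F = 0" "F - G = F + - G"
    by (transfer; simp add: fun_eq_iff)+
  show "(0 :: mseries) \<noteq> 1"
    by transfer (auto simp: fun_eq_iff)
qed

end

lift_definition mconst :: "rat \<Rightarrow> mseries" is "\<lambda>c m. if m = 0 then c else 0" .

definition mdeg :: "monomial \<Rightarrow> nat" where
  "mdeg m = (\<Sum>i\<in>Poly_Mapping.keys m. Poly_Mapping.lookup m i)"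

definition symmetric_series :: "mseries \<Rightarrow> bool" where
  "symmetric_series F \<longleftrightarrow>
     (\<forall>\<pi>. bij \<pi> \<longrightarrow> (\<forall>m. mcoeff F (Poly_Mapping.map_key \<pi> m) = mcoeff F m))"

definition Lambda :: "nat \<Rightarrow> mseries set" where
  "Lambda n = {F. symmetric_series F \<and> (\<forall>m. mcoeff F m \<noteq> 0 \<longrightarrow> mdeg m = n)}"

text \<open>The subalgebra of symmetric series of bounded degree, i.e. the direct sum of all
  \<open>Lambda n\<close>. On the full product of the \<open>Lambda n\<close>, plethysm with a fixed \<open>G\<close> having a
  constant term is undefined, and otherwise the values on power sums determine an algebra
  homomorphism only under an additional continuity requirement.\<close>

definition Lambda_bounded :: "mseries set" where
  "Lambda_bounded = {F. symmetric_series F \<and> (\<exists>d. \<forall>m. mcoeff F m \<noteq> 0 \<longrightarrow> mdeg m \<le> d)}"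

text \<open>Only used for \<open>r \<ge> 1\<close>.\<close>

lift_definition power_sum :: "nat \<Rightarrow> mseries"
  is "\<lambda>r m. if \<exists>i. m = Poly_Mapping.single i r then 1 else 0" .

definition partitions_of :: "nat \<Rightarrow> nat multiset set" where
  "partitions_of n = {la. 0 \<notin># la \<and> sum_mset la = n}"

definition power_sum_prod :: "nat multiset \<Rightarrow> mseries" where
  "power_sum_prod la = (\<Prod>r\<in>#la. power_sum r)"

text \<open>The description is meaningful for homogeneous \<open>F\<close>, since the \<open>power_sum_prod la\<close> with
  \<open>la \<in> partitions_of n\<close> form a basis of \<open>Lambda n\<close>. The degree \<open>n\<close> is determined by \<open>F\<close>
  unless \<open>F = 0\<close>, where every \<open>n\<close> gives the zero polynomial.\<close>

definition char_polynomial :: "mseries \<Rightarrow> rat poly" where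
  "char_polynomial F = (THE P. \<exists>n c. F \<in> Lambda n \<and>
     F = (\<Sum>la\<in>partitions_of n. mconst (c la) * power_sum_prod la) \<and>
     P = (\<Sum>la\<in>partitions_of n. monom (c la) (size la)))"

text \<open>The substitution \<open>G(x\<^sub>1\<^sup>r, x\<^sub>2\<^sup>r, \<dots>)\<close>, for \<open>r \<ge> 1\<close>: the coefficient of \<open>m\<close> is that of its
  \<open>r\<close>-th root, the index set having at most one element.\<close>

lift_definition subst_power :: "nat \<Rightarrow> mseries \<Rightarrow> mseries"
  is "\<lambda>r G m. \<Sum>m' | Poly_Mapping.map ((*) r) m' = m. G m'" .

definition plethysm_hom :: "mseries \<Rightarrow> (mseries \<Rightarrow> mseries) \<Rightarrow> bool" where
  "plethysm_hom G \<phi> \<longleftrightarrow>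
     (\<forall>r\<ge>1. \<phi> (power_sum r) = subst_power r G) \<and>
     (\<forall>c. \<phi> (mconst c) = mconst c) \<and>
     (\<forall>F\<in>Lambda_bounded. \<forall>H\<in>Lambda_bounded.
        \<phi> (F + H) = \<phi> F + \<phi> H \<and> \<phi> (F * H) = \<phi> F * \<phi> H)"

text \<open>A map as in \<open>plethysm_hom\<close> exists and is unique on \<open>Lambda_bounded\<close>, because this algebra
  is freely generated by the power sums.\<close>

definition plethysm :: "mseries \<Rightarrow> mseries \<Rightarrow> mseries" where
  "plethysm F G = (THE H. \<exists>\<phi>. plethysm_hom G \<phi> \<and> H = \<phi> F)"

end

(* The power sum products form a basis of the symmetric series: the coefficient of a monomial with
   k variables in p_la vanishes unless k is at most the length of la, and for k equal to the length
   it is nonzero exactly at the monomials of exponent type la. Hence symmetric series of bounded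
   degree form a polynomial ring in the power sums, plethysm with G exists as the substitution of
   p_r o G for p_r, and the characteristic polynomial is the substitution of m for every p_r. As
   p_r o p_s = p_(r s), each p_r o G has the same characteristic polynomial as G, so that both sides
   of the identity substitute the characteristic polynomial of G for every p_r in F. *)

theory Submission
  imports Defs "HOL-Combinatorics.Permutations"
begin

section \<open>Polynomials in countably many indeterminates\<close>

text \<open>The convolution ring \<open>nat multiset \<Rightarrow>\<^sub>0 rat\<close> is the polynomial ring over the rationals whose
  indeterminates are indexed by the natural numbers. As power sums are indexed from 1, the
  indeterminate with index \<open>r\<close> will stand for \<open>power_sum (Suc r)\<close>.\<close>

type_synonym ipoly = "nat multiset \<Rightarrow>\<^sub>0 rat"

text \<open>The coefficient maps in play are \<open>mconst\<close>, \<open>\<lambda>c. [:c:]\<close>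
  and \<open>Poly_Mapping.single 0\<close>; abstracting over them lets one substitution map serve
  series, univariate polynomials and \<open>ipoly\<close> alike.\<close>

definition coeff_hom :: "(rat \<Rightarrow> 'b::comm_ring_1) \<Rightarrow> bool" where
  "coeff_hom k \<longleftrightarrow> k 1 = 1 \<and> (\<forall>x y. k (x + y) = k x + k y \<and> k (x * y) = k x * k y)"

lemma coeff_hom_simps:
  assumes "coeff_hom k"
  shows "k 0 = 0" "k 1 = 1" "k (x + y) = k x + k y" "k (x * y) = k x * k y"
proof -
  have "k (0 + 0) = k 0 + k 0"
    using assms unfolding coeff_hom_def by blast
  then show "k 0 = 0"
    by simp
qed (use assms in \<open>simp_all add: coeff_hom_def\<close>)

text \<open>The substitution homomorphism from the universal property of the polynomial
  ring.\<close>

definition eval_ipoly :: "(rat \<Rightarrow> 'b::comm_ring_1) \<Rightarrow> (nat \<Rightarrow> 'b) \<Rightarrow> ipoly \<Rightarrow> 'b" where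
  "eval_ipoly k h f =
     (\<Sum>\<nu>\<in>Poly_Mapping.keys f. k (Poly_Mapping.lookup f \<nu>) * (\<Prod>r\<in>#\<nu>. h r))"

lemma eval_ipoly_0 [simp]: "eval_ipoly k h 0 = 0"
  by (simp add: eval_ipoly_def)

lemma eval_ipoly_single:
  assumes "coeff_hom k"
  shows "eval_ipoly k h (Poly_Mapping.single \<nu> c) = k c * (\<Prod>r\<in>#\<nu>. h r)"
  using coeff_hom_simps[OF assms] by (simp add: eval_ipoly_def)

lemma eval_ipoly_add:
  assumes "coeff_hom k"
  shows "eval_ipoly k h (f + g) = eval_ipoly k h f + eval_ipoly k h g"
  unfolding eval_ipoly_def
  by (rule setsum_keys_plus_distrib) (simp_all add: coeff_hom_simps[OF assms] distrib_right)

lemma eval_ipoly_sum: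
  assumes "coeff_hom k"
  shows "eval_ipoly k h (\<Sum>i\<in>I. f i) = (\<Sum>i\<in>I. eval_ipoly k h (f i))"
  by (induction I rule: infinite_finite_induct) (simp_all add: eval_ipoly_add[OF assms])

lemma ipoly_induct [case_names zero add]:
  assumes "P 0"
    and add: "\<And>f \<nu> c. P f \<Longrightarrow> P (Poly_Mapping.single \<nu> c + f)"
  shows "P (f :: ipoly)"
proof (induction f rule: Poly_Mapping.update_induct)
  case const
  show ?case by fact
next
  case (update f \<nu> c)
  \<comment> \<open>As \<open>\<nu>\<close> is not a key of \<open>f\<close>, updating there amounts
    to adding one term.\<close>
  have "Poly_Mapping.update \<nu> c f = Poly_Mapping.single \<nu> c + f"
    using update(1)
    by (intro poly_mapping_eqI)
      (auto simp: lookup_add lookup_single update.rep_eq in_keys_iff when_def)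
  then show ?case
    using add[OF update(3)] by simp
qed

text \<open>By bilinearity it is enough to treat products of two single terms, where the multisets
  of indeterminates add.\<close>

lemma eval_ipoly_mult:
  assumes "coeff_hom k"
  shows "eval_ipoly k h (f * g) = eval_ipoly k h f * eval_ipoly k h g"
proof (induction f rule: ipoly_induct)
  case (add f \<mu> b)
  have "eval_ipoly k h (Poly_Mapping.single \<mu> b * g)
    = eval_ipoly k h (Poly_Mapping.single \<mu> b) * eval_ipoly k h g"
  proof (induction g rule: ipoly_induct)
    case (add g \<nu> c)
    then show ?case
      by (simp add: eval_ipoly_add[OF assms] eval_ipoly_single[OF assms] mult_single
          coeff_hom_simps[OF assms] algebra_simps)
  qed simp
  with add show ?case
    by (simp add: distrib_right eval_ipoly_add[OF assms])
qed simp

text \<open>Uniqueness in the universal property: a homomorphism is determined by its values on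
  coefficients and indeterminates. The set \<open>S\<close> is a parameter because a plethysm map is
  only known to respect sums and products on \<open>Lambda_bounded\<close>; elsewhere
  \<open>S\<close> is \<open>UNIV\<close>.\<close>

lemma hom_eval_ipoly:
  assumes h: "\<And>r. h r \<in> S" and k: "\<And>c. k c \<in> S"
    and S: "\<And>x y. x \<in> S \<Longrightarrow> y \<in> S \<Longrightarrow> x + y \<in> S \<and> x * y \<in> S"
    and hom: "coeff_hom k" and hom': "coeff_hom k'" and \<theta>_k: "\<And>c. \<theta> (k c) = k' c"
    and \<theta>: "\<And>x y. x \<in> S \<Longrightarrow> y \<in> S \<Longrightarrow> \<theta> (x + y) = \<theta> x + \<theta> y \<and> \<theta> (x * y) = \<theta> x * \<theta> y"
  shows "\<theta> (eval_ipoly k h f) = eval_ipoly k' (\<lambda>r. \<theta> (h r)) f"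
proof -
  have prod_in: "(\<Prod>r\<in>#\<nu>. h r) \<in> S" for \<nu>
  proof (induction \<nu>)
    case empty
    show ?case using k[of 1] coeff_hom_simps(2)[OF hom] by simp
  qed (use S h in simp)
  have in_S: "eval_ipoly k h f \<in> S" for f
  proof (induction f rule: ipoly_induct)
    case zero
    show ?case using k[of 0] coeff_hom_simps(1)[OF hom] by simp
  qed (use S k prod_in in \<open>simp add: eval_ipoly_add[OF hom] eval_ipoly_single[OF hom]\<close>)
  have \<theta>_prod: "\<theta> (\<Prod>r\<in>#\<nu>. h r) = (\<Prod>r\<in>#\<nu>. \<theta> (h r))" for \<nu>
  proof (induction \<nu>)
    case empty
    show ?case
      using \<theta>_k[of 1] coeff_hom_simps(2)[OF hom] coeff_hom_simps(2)[OF hom'] by simp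
  qed (use \<theta> h prod_in in simp)
  show "\<theta> (eval_ipoly k h f) = eval_ipoly k' (\<lambda>r. \<theta> (h r)) f"
  proof (induction f rule: ipoly_induct)
    case zero
    show ?case
      using \<theta>_k[of 0] coeff_hom_simps(1)[OF hom] coeff_hom_simps(1)[OF hom'] by simp
  next
    case (add f \<nu> c)
    have "k c * (\<Prod>r\<in>#\<nu>. h r) \<in> S"
      using S k prod_in by blast
    with add show ?case
      using \<theta> k in_S prod_in
      by (simp add: eval_ipoly_add[OF hom] eval_ipoly_single[OF hom]
          eval_ipoly_add[OF hom'] eval_ipoly_single[OF hom'] \<theta>_k \<theta>_prod)
  qed
qed

section \<open>The three coefficient maps\<close>

lemma mcoeff_mconst_mult: "mcoeff (mconst c * F) m = c * mcoeff F m"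
proof -
  have "mcoeff (mconst c * F) m = (\<Sum>(a, b)\<in>{(0, m)}. mcoeff (mconst c) a * mcoeff F b)"
    unfolding times_mseries.rep_eq
    by (rule sum.mono_neutral_right)
      (auto simp: finite_monomial_splits mconst.rep_eq split: if_splits)
  then show ?thesis
    by (simp add: mconst.rep_eq)
qed

lemma coeff_hom_mconst: "coeff_hom mconst"
  unfolding coeff_hom_def
proof (intro conjI allI)
  show "mconst 1 = 1"
    by (rule mseries_eqI) (simp add: mconst.rep_eq one_mseries.rep_eq)
  fix x y
  show "mconst (x + y) = mconst x + mconst y"
    by (rule mseries_eqI) (simp add: mconst.rep_eq plus_mseries.rep_eq)
  show "mconst (x * y) = mconst x * mconst y"
    by (rule mseries_eqI) (simp add: mcoeff_mconst_mult mconst.rep_eq)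
qed

lemma coeff_hom_pCons: "coeff_hom (\<lambda>c. [:c:])"
  by (simp add: coeff_hom_def one_pCons)

lemma coeff_hom_single: "coeff_hom (Poly_Mapping.single 0 :: rat \<Rightarrow> ipoly)"
  by (simp add: coeff_hom_def single_add mult_single)

section \<open>Symmetric series\<close>

lemma mcoeff_sum: "mcoeff (\<Sum>i\<in>I. F i) m = (\<Sum>i\<in>I. mcoeff (F i) m)"
  by (induction I rule: infinite_finite_induct) (simp_all add: zero_mseries.rep_eq plus_mseries.rep_eq)

lemma mcoeff_mult_nonzero:
  assumes "mcoeff (F * G) m \<noteq> 0"
  obtains a b where "a + b = m" "mcoeff F a \<noteq> 0" "mcoeff G b \<noteq> 0"
  using assms unfolding times_mseries.rep_eq by (auto elim!: sum.not_neutral_contains_not_neutral)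

text \<open>The exponent type of a monomial, a partition of its degree.\<close>

definition exponents :: "monomial \<Rightarrow> nat multiset" where
  "exponents m = image_mset (Poly_Mapping.lookup m) (mset_set (Poly_Mapping.keys m))"

lemma mdeg_exponents: "mdeg m = sum_mset (exponents m)"
  by (simp add: mdeg_def exponents_def sum_unfold_sum_mset)

lemma size_exponents: "size (exponents m) = card (Poly_Mapping.keys m)"
  by (simp add: exponents_def)

lemma mdeg_superset:
  assumes "finite A" "Poly_Mapping.keys m \<subseteq> A"
  shows "mdeg m = (\<Sum>i\<in>A. Poly_Mapping.lookup m i)"
  unfolding mdeg_def using assms by (intro sum.mono_neutral_left) (auto simp: in_keys_iff)

lemma mdeg_add: "mdeg (a + b) = mdeg a + mdeg b"
proof -
  let ?A = "Poly_Mapping.keys a \<union> Poly_Mapping.keys b"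
  have "Poly_Mapping.keys (a + b) \<subseteq> ?A"
    by (rule Poly_Mapping.keys_add)
  then show ?thesis
    by (simp add: mdeg_superset[of ?A] lookup_add sum.distrib)
qed

text \<open>Monomials of equal exponent type differ by a permutation of the variables. To make it a
  bijection of all variables, both are read on the union of their supports, padded with zero
  exponents; off this finite set the permutation is the identity.\<close>

lemma mcoeff_eq_if_exponents_eq:
  assumes "symmetric_series F" "exponents m = exponents m'"
  shows "mcoeff F m = mcoeff F m'"
proof -
  let ?A = "Poly_Mapping.keys m \<union> Poly_Mapping.keys m'"
  have pad: "image_mset (Poly_Mapping.lookup x) (mset_set ?A)
      = exponents x + replicate_mset (card ?A - card (Poly_Mapping.keys x)) 0"
    if "x \<in> {m, m'}" for x
  proof -
    have sub: "Poly_Mapping.keys x \<subseteq> ?A"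
      using that by auto
    have "mset_set ?A = mset_set (Poly_Mapping.keys x) + mset_set (?A - Poly_Mapping.keys x)"
      by (subst mset_set_Union[symmetric]) (use sub in \<open>auto intro!: arg_cong[of _ _ mset_set]\<close>)
    moreover have "image_mset (Poly_Mapping.lookup x) (mset_set (?A - Poly_Mapping.keys x))
        = image_mset (\<lambda>_. 0) (mset_set (?A - Poly_Mapping.keys x))"
      by (rule image_mset_cong) (auto simp: in_keys_iff)
    moreover have "card (?A - Poly_Mapping.keys x) = card ?A - card (Poly_Mapping.keys x)"
      by (rule card_Diff_subset) (use sub in auto)
    ultimately show ?thesis
      by (simp add: exponents_def image_mset_const_eq)
  qed
  have "card (Poly_Mapping.keys m) = card (Poly_Mapping.keys m')"
    using assms(2) by (metis size_exponents)
  then have "image_mset (Poly_Mapping.lookup m) (mset_set ?A)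
      = image_mset (Poly_Mapping.lookup m') (mset_set ?A)"
    using pad assms(2) by simp
  then obtain p where p: "p permutes ?A"
    and eq: "\<forall>i\<in>?A. Poly_Mapping.lookup m i = Poly_Mapping.lookup m' (p i)"
    using image_mset_eq_implies_permutes[of ?A] by auto
  have "inj p" "bij p"
    using p by (simp_all add: permutes_inj permutes_bij)
  have "Poly_Mapping.map_key p m' = m"
  proof (rule poly_mapping_eqI)
    fix i
    show "Poly_Mapping.lookup (Poly_Mapping.map_key p m') i = Poly_Mapping.lookup m i"
    proof (cases "i \<in> ?A")
      case True
      then show ?thesis
        using eq by (simp add: map_key.rep_eq[OF \<open>inj p\<close>])
    next
      case False
      then show ?thesis
        using permutes_not_in[OF p] by (simp add: map_key.rep_eq[OF \<open>inj p\<close>] in_keys_iff)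
    qed
  qed
  then show ?thesis
    using assms(1) \<open>bij p\<close> unfolding symmetric_series_def by metis
qed

section \<open>Closure properties of symmetric series\<close>

lemma symmetric_series_add:
  "symmetric_series F \<Longrightarrow> symmetric_series G \<Longrightarrow> symmetric_series (F + G)"
  by (simp add: symmetric_series_def plus_mseries.rep_eq)

lemma symmetric_series_sum:
  "(\<And>i. i \<in> I \<Longrightarrow> symmetric_series (F i)) \<Longrightarrow> symmetric_series (\<Sum>i\<in>I. F i)"
  by (auto simp: symmetric_series_def mcoeff_sum)

lemma symmetric_series_diff:
  "symmetric_series F \<Longrightarrow> symmetric_series G \<Longrightarrow> symmetric_series (F - G)"
  by (simp add: symmetric_series_def minus_mseries.rep_eq)

lemma map_key_inv:
  fixes \<pi> :: "'a \<Rightarrow> 'a"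
  assumes "bij \<pi>"
  shows "Poly_Mapping.map_key \<pi> (Poly_Mapping.map_key (inv \<pi>) m) = m"
    "Poly_Mapping.map_key (inv \<pi>) (Poly_Mapping.map_key \<pi> m) = m"
proof -
  have inj: "inj \<pi>" "inj (inv \<pi>)"
    using assms by (simp_all add: bij_is_inj bij_imp_bij_inv)
  show "Poly_Mapping.map_key \<pi> (Poly_Mapping.map_key (inv \<pi>) m) = m"
    "Poly_Mapping.map_key (inv \<pi>) (Poly_Mapping.map_key \<pi> m) = m"
    using assms by (auto intro!: poly_mapping_eqI
        simp: map_key.rep_eq[OF inj(1)] map_key.rep_eq[OF inj(2)] bij_is_inj bij_is_surj surj_f_inv_f)
qed

lemma map_key_eq_0_iff:
  fixes \<pi> :: "'a \<Rightarrow> 'a"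
  assumes "bij \<pi>"
  shows "Poly_Mapping.map_key \<pi> m = 0 \<longleftrightarrow> m = 0"
proof -
  have "inj \<pi>" "inj (inv \<pi>)"
    using assms by (simp_all add: bij_is_inj bij_imp_bij_inv)
  then show ?thesis
    using map_key_inv[OF assms, of m] by (metis map_key_zero)
qed

lemma symmetric_series_mconst: "symmetric_series (mconst c)"
  by (simp add: symmetric_series_def mconst.rep_eq map_key_eq_0_iff)

lemma symmetric_series_mult:
  assumes "symmetric_series F" "symmetric_series G"
  shows "symmetric_series (F * G)"
  unfolding symmetric_series_def
proof (intro allI impI)
  fix \<pi> :: "nat \<Rightarrow> nat" and m :: monomial
  assume \<pi>: "bij \<pi>"
  have inj: "inj \<pi>" "inj (inv \<pi>)"
    using \<pi> by (simp_all add: bij_is_inj bij_imp_bij_inv)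
  have "mcoeff F (Poly_Mapping.map_key \<pi> a) = mcoeff F a"
    "mcoeff G (Poly_Mapping.map_key \<pi> a) = mcoeff G a" for a
    using assms \<pi> by (auto simp: symmetric_series_def)
  moreover have "Poly_Mapping.map_key (inv \<pi>) a + Poly_Mapping.map_key (inv \<pi>) b = m"
    if "a + b = Poly_Mapping.map_key \<pi> m" for a b
    using that map_key_inv(2)[OF \<pi>] by (metis map_key_plus[OF inj(2)])
  \<comment> \<open>Renaming both factors is a bijection from the splittings of \<open>m\<close> to
    those of \<open>map_key \<pi> m\<close>.\<close>
  ultimately show "mcoeff (F * G) (Poly_Mapping.map_key \<pi> m) = mcoeff (F * G) m"
    unfolding times_mseries.rep_eq
    by (intro sum.reindex_bij_witness[where
          j = "map_prod (Poly_Mapping.map_key (inv \<pi>)) (Poly_Mapping.map_key (inv \<pi>))" and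
          i = "map_prod (Poly_Mapping.map_key \<pi>) (Poly_Mapping.map_key \<pi>)"])
      (auto simp: map_key_inv[OF \<pi>] map_key_plus[OF inj(1)], metis map_key_inv(1)[OF \<pi>])
qed

lemma symmetric_series_power_sum: "symmetric_series (power_sum r)"
  unfolding symmetric_series_def
proof (intro allI impI)
  fix \<pi> :: "nat \<Rightarrow> nat" and m :: monomial
  assume \<pi>: "bij \<pi>"
  have inj: "inj \<pi>"
    using \<pi> by (rule bij_is_inj)
  have *: "Poly_Mapping.map_key \<pi> (Poly_Mapping.single (\<pi> i) r) = Poly_Mapping.single i r" for i
    using inj by (rule map_key_single)
  have "(\<exists>i. Poly_Mapping.map_key \<pi> m = Poly_Mapping.single i r) \<longleftrightarrow> (\<exists>i. m = Poly_Mapping.single i r)"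
    by (metis * map_key_inv(2)[OF \<pi>] \<pi> bij_pointE)
  then show "mcoeff (power_sum r) (Poly_Mapping.map_key \<pi> m) = mcoeff (power_sum r) m"
    by (simp add: power_sum.rep_eq)
qed

section \<open>Homogeneous pieces and bounded degree\<close>

lemma mult_in_Lambda: "F \<in> Lambda a \<Longrightarrow> G \<in> Lambda b \<Longrightarrow> F * G \<in> Lambda (a + b)"
  unfolding Lambda_def
  by (auto simp: symmetric_series_mult mdeg_add elim!: mcoeff_mult_nonzero)

lemma zero_in_Lambda: "0 \<in> Lambda n"
  by (simp add: Lambda_def symmetric_series_def zero_mseries.rep_eq)

lemma add_in_Lambda: "F \<in> Lambda n \<Longrightarrow> G \<in> Lambda n \<Longrightarrow> F + G \<in> Lambda n"
  unfolding Lambda_def by (force simp: symmetric_series_add plus_mseries.rep_eq)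

lemma sum_in_Lambda: "(\<And>i. i \<in> I \<Longrightarrow> F i \<in> Lambda n) \<Longrightarrow> (\<Sum>i\<in>I. F i) \<in> Lambda n"
  by (induction I rule: infinite_finite_induct) (auto simp: zero_in_Lambda add_in_Lambda)

lemma mconst_in_Lambda: "mconst c \<in> Lambda 0"
  by (auto simp: Lambda_def symmetric_series_mconst mconst.rep_eq mdeg_def)

lemma power_sum_in_Lambda: "power_sum r \<in> Lambda r"
  by (auto simp: Lambda_def symmetric_series_power_sum power_sum.rep_eq mdeg_def split: if_splits)

lemma prod_mset_in_Lambda:
  assumes "\<And>r. r \<in># \<nu> \<Longrightarrow> h r \<in> Lambda (d r)"
  shows "(\<Prod>r\<in>#\<nu>. h r) \<in> Lambda (\<Sum>r\<in>#\<nu>. d r)"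
  using assms
proof (induction \<nu>)
  case empty
  then show ?case
    using mconst_in_Lambda[of 1] by (simp add: coeff_hom_simps(2)[OF coeff_hom_mconst])
qed (simp add: mult_in_Lambda)

lemma power_sum_prod_in_Lambda: "power_sum_prod la \<in> Lambda (sum_mset la)"
  unfolding power_sum_prod_def
  using prod_mset_in_Lambda[of la power_sum "\<lambda>r. r"] power_sum_in_Lambda by simp

lemma Lambda_subset_bounded: "Lambda n \<subseteq> Lambda_bounded"
  by (auto simp: Lambda_def Lambda_bounded_def)

lemma Lambda_bounded_add_mult:
  assumes "F \<in> Lambda_bounded" "G \<in> Lambda_bounded"
  shows "F + G \<in> Lambda_bounded \<and> F * G \<in> Lambda_bounded"
proof -
  obtain d e where d: "\<And>m. mcoeff F m \<noteq> 0 \<Longrightarrow> mdeg m \<le> d" "\<And>m. mcoeff G m \<noteq> 0 \<Longrightarrow> mdeg m \<le> e"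
    using assms unfolding Lambda_bounded_def by auto
  have "mdeg m \<le> d + e" if "mcoeff (F + G) m \<noteq> 0" for m
  proof -
    have "mcoeff F m \<noteq> 0 \<or> mcoeff G m \<noteq> 0"
      using that by (auto simp: plus_mseries.rep_eq)
    then show ?thesis
      using d by force
  qed
  moreover have "mdeg m \<le> d + e" if "mcoeff (F * G) m \<noteq> 0" for m
    using that by (rule mcoeff_mult_nonzero) (use d in \<open>auto simp: mdeg_add add_mono\<close>)
  ultimately show ?thesis
    using assms unfolding Lambda_bounded_def
    by (auto simp: symmetric_series_add symmetric_series_mult)
qed

section \<open>The power sum products form a basis\<close>

text \<open>Freshness of \<open>i\<close> is what creates a new part; if \<open>i\<close> occurred
  in \<open>b\<close>, two exponents would merge.\<close>

lemma exponents_single_add: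
  assumes "i \<notin> Poly_Mapping.keys b" "r \<noteq> 0"
  shows "exponents (Poly_Mapping.single i r + b) = add_mset r (exponents b)"
proof -
  have "Poly_Mapping.keys (Poly_Mapping.single i r + b) = insert i (Poly_Mapping.keys b)"
    using assms by (auto simp: in_keys_iff lookup_add lookup_single when_def split: if_splits)
  moreover have "image_mset (Poly_Mapping.lookup (Poly_Mapping.single i r + b)) (mset_set (Poly_Mapping.keys b))
      = exponents b"
    unfolding exponents_def using assms
    by (intro image_mset_cong) (auto simp: lookup_add lookup_single when_def)
  moreover have "Poly_Mapping.lookup (Poly_Mapping.single i r + b) i = r"
    using assms by (simp add: lookup_add in_keys_iff)
  ultimately show ?thesis
    using assms by (simp add: exponents_def)
qed

lemma zero_notin_exponents: "0 \<notin># exponents m"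
  by (auto simp: exponents_def in_keys_iff)

text \<open>The parts are placed one by one on fresh variables, of which there are infinitely
  many.\<close>

lemma exponents_surj:
  assumes "0 \<notin># la"
  obtains m where "exponents m = la"
proof -
  from assms have "\<exists>m. exponents m = la"
  proof (induction la)
    case empty
    have "exponents 0 = {#}"
      by (simp add: exponents_def)
    then show ?case by blast
  next
    case (add r la)
    then obtain b where b: "exponents b = la"
      by auto
    obtain i where "i \<notin> Poly_Mapping.keys b"
      using ex_new_if_finite[OF infinite_UNIV_nat finite_keys] by blast
    then have "exponents (Poly_Mapping.single i r + b) = add_mset r la"
      using exponents_single_add[of i b r] b add.prems by auto
    then show ?case by blast
  qed
  with that show thesis by blast
qed

section \<open>Triangularity of power sum products with respect to exponent types\<close>

lemma power_sum_prod_empty [simp]: "power_sum_prod {#} = 1"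
  by (simp add: power_sum_prod_def)

lemma power_sum_prod_add_mset [simp]:
  "power_sum_prod (add_mset r la) = power_sum r * power_sum_prod la"
  by (simp add: power_sum_prod_def)

text \<open>Rules out cancellation, so that a single positive term makes a coefficient
  positive.\<close>

lemma mcoeff_power_sum_prod_nonneg: "0 \<le> mcoeff (power_sum_prod la) m"
proof (induction la arbitrary: m)
  case empty
  show ?case by (simp add: one_mseries.rep_eq)
next
  case (add r la)
  then show ?case
    by (auto simp: times_mseries.rep_eq power_sum.rep_eq intro!: sum_nonneg)
qed

text \<open>Each factor of the product contributes a power of one variable and thus at most one new
  variable. If the bound is attained, every factor uses a fresh variable, so no exponents
  merge.\<close>

lemma mcoeff_power_sum_prod_triangular:
  assumes "0 \<notin># la" "mcoeff (power_sum_prod la) m \<noteq> 0"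
  shows "card (Poly_Mapping.keys m) \<le> size la"
    and "card (Poly_Mapping.keys m) = size la \<Longrightarrow> exponents m = la"
proof -
  from assms have "card (Poly_Mapping.keys m) \<le> size la \<and>
      (card (Poly_Mapping.keys m) = size la \<longrightarrow> exponents m = la)"
  proof (induction la arbitrary: m)
    case empty
    then show ?case
      by (auto simp: one_mseries.rep_eq exponents_def split: if_splits)
  next
    case (add r la)
    from add.prems(2) obtain a b where ab: "a + b = m" "mcoeff (power_sum r) a \<noteq> 0"
      "mcoeff (power_sum_prod la) b \<noteq> 0"
      by (auto elim: mcoeff_mult_nonzero)
    then obtain i where i: "a = Poly_Mapping.single i r"
      by (auto simp: power_sum.rep_eq split: if_splits)
    from add.prems(1) have r: "r \<noteq> 0" and la: "0 \<notin># la"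
      by auto
    note IH = add.IH[OF la ab(3)]
    show ?case
    proof (cases "i \<in> Poly_Mapping.keys b")
      \<comment> \<open>The variable repeats, so \<open>m\<close> has at most \<open>size la\<close>
        variables, fewer than the number of factors; the equality case is vacuous.\<close>
      case True
      then have "Poly_Mapping.keys m \<subseteq> Poly_Mapping.keys b"
        using keys_add[of a b] ab(1) r by (auto simp: i)
      then have "card (Poly_Mapping.keys m) \<le> card (Poly_Mapping.keys b)"
        by (simp add: card_mono)
      with IH show ?thesis by simp
    next
      case False
      then have e: "exponents m = add_mset r (exponents b)"
        using exponents_single_add[OF False r] ab(1) by (simp add: i)
      then have "card (Poly_Mapping.keys m) = Suc (card (Poly_Mapping.keys b))"
        by (metis size_exponents size_add_mset)
      with IH e show ?thesis by simp
    qed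
  qed
  then show "card (Poly_Mapping.keys m) \<le> size la"
    and "card (Poly_Mapping.keys m) = size la \<Longrightarrow> exponents m = la"
    by blast+
qed

text \<open>Distributing the parts over the variables of \<open>m\<close> gives one positive term in
  the convolution, and the other terms are nonnegative.\<close>

lemma mcoeff_power_sum_prod_pos: "0 < mcoeff (power_sum_prod (exponents m)) m"
proof -
  have "0 < mcoeff (power_sum_prod la) m" if "exponents m = la" for la
    using that
  proof (induction la arbitrary: m)
    case empty
    then show ?case
      by (auto simp: one_mseries.rep_eq exponents_def mset_set_empty_iff)
  next
    case (add r la)
    then have r: "r \<in># exponents m"
      by simp
    then obtain i where i: "i \<in> Poly_Mapping.keys m" "Poly_Mapping.lookup m i = r"
      by (auto simp: exponents_def)
    have "r \<noteq> 0"
      using r zero_notin_exponents by metis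
    \<comment> \<open>Strips from \<open>m\<close> a variable whose exponent is the part
      \<open>r\<close>.\<close>
    define b where "b = m - Poly_Mapping.single i r"
    have m: "Poly_Mapping.single i r + b = m"
      using i by (intro poly_mapping_eqI) (auto simp: b_def lookup_add lookup_minus lookup_single when_def)
    have "i \<notin> Poly_Mapping.keys b"
      using i by (simp add: b_def in_keys_iff lookup_minus)
    then have "exponents b = la"
      using exponents_single_add[of i b r] \<open>r \<noteq> 0\<close> add.prems m by simp
    then have "0 < mcoeff (power_sum r) (Poly_Mapping.single i r) * mcoeff (power_sum_prod la) b"
      using add.IH by (auto simp: power_sum.rep_eq)
    also have "\<dots> = (\<Sum>(a, b)\<in>{(Poly_Mapping.single i r, b)}. mcoeff (power_sum r) a * mcoeff (power_sum_prod la) b)"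
      by simp
    also have "\<dots> \<le> mcoeff (power_sum_prod (add_mset r la)) m"
      unfolding power_sum_prod_add_mset times_mseries.rep_eq
      by (rule sum_mono2)
        (use m mcoeff_power_sum_prod_nonneg in \<open>auto simp: finite_monomial_splits power_sum.rep_eq\<close>)
    finally show ?case .
  qed
  then show ?thesis by simp
qed

text \<open>The coordinates for everything that follows: this map is injective by
  \<open>inj_psum_eval\<close> and reaches all of \<open>Lambda_bounded\<close> by
  \<open>Lambda_bounded_psum_eval\<close>.\<close>

definition psum_eval :: "ipoly \<Rightarrow> mseries" where
  "psum_eval = eval_ipoly mconst (\<lambda>r. power_sum (Suc r))"

lemma psum_eval_altdef:
  "psum_eval f = (\<Sum>\<nu>\<in>Poly_Mapping.keys f.
     mconst (Poly_Mapping.lookup f \<nu>) * power_sum_prod (image_mset Suc \<nu>))"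
  by (simp add: psum_eval_def eval_ipoly_def power_sum_prod_def image_mset.compositionality comp_def)

lemma psum_eval_single:
  "psum_eval (Poly_Mapping.single \<nu> c) = mconst c * power_sum_prod (image_mset Suc \<nu>)"
  by (simp add: psum_eval_def eval_ipoly_single[OF coeff_hom_mconst] power_sum_prod_def
      image_mset.compositionality comp_def)

text \<open>Linear independence: take a term \<open>\<nu>\<close> of maximal size and look at a
  monomial whose exponent type matches it. By triangularity no other term of \<open>f\<close>
  contributes there.\<close>

lemma psum_eval_eq_0:
  assumes "psum_eval f = 0"
  shows "f = 0"
proof (rule ccontr)
  assume "f \<noteq> 0"
  let ?K = "Poly_Mapping.keys f"
  have "?K \<noteq> {}"
    using \<open>f \<noteq> 0\<close> by simp
  then have "Max (size ` ?K) \<in> size ` ?K"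
    by (intro Max_in) auto
  then obtain \<nu> where \<nu>: "\<nu> \<in> ?K" "\<And>\<mu>. \<mu> \<in> ?K \<Longrightarrow> size \<mu> \<le> size \<nu>"
    by (metis (no_types, lifting) Max_ge finite_imageI finite_keys image_eqI imageE)
  obtain m where m: "exponents m = image_mset Suc \<nu>"
    by (rule exponents_surj[of "image_mset Suc \<nu>"]) auto
  have off: "mcoeff (power_sum_prod (image_mset Suc \<mu>)) m = 0" if "\<mu> \<in> ?K - {\<nu>}" for \<mu>
  proof (rule ccontr)
    assume *: "mcoeff (power_sum_prod (image_mset Suc \<mu>)) m \<noteq> 0"
    have c: "card (Poly_Mapping.keys m) = size \<nu>"
      using m by (metis size_exponents size_image_mset)
    \<comment> \<open>Triangularity bounds \<open>size \<nu>\<close> by \<open>size \<mu>\<close>,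
      maximality gives the converse, and the equality case identifies the two types.\<close>
    have "card (Poly_Mapping.keys m) \<le> size \<mu>"
      using mcoeff_power_sum_prod_triangular(1)[OF _ *] by auto
    then have "image_mset Suc \<nu> = image_mset Suc \<mu>"
      using mcoeff_power_sum_prod_triangular(2)[OF _ *] \<nu>(2)[of \<mu>] that c m by auto
    then have "\<nu> = \<mu>"
      using injD[OF multiset.inj_map[OF inj_Suc]] by blast
    with that show False by simp
  qed
  have "0 = mcoeff (psum_eval f) m"
    by (simp add: assms zero_mseries.rep_eq)
  also have "\<dots> = (\<Sum>\<mu>\<in>?K. Poly_Mapping.lookup f \<mu> * mcoeff (power_sum_prod (image_mset Suc \<mu>)) m)"
    by (simp add: psum_eval_altdef mcoeff_sum mcoeff_mconst_mult)
  also have "\<dots> = (\<Sum>\<mu>\<in>{\<nu>}. Poly_Mapping.lookup f \<mu> * mcoeff (power_sum_prod (image_mset Suc \<mu>)) m)"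
    by (rule sum.mono_neutral_right) (use \<nu>(1) off in auto)
  also have "\<dots> \<noteq> 0"
    using \<nu>(1) mcoeff_power_sum_prod_pos[of m] m by (simp add: in_keys_iff)
  finally show False by simp
qed

lemma psum_eval_add: "psum_eval (f + g) = psum_eval f + psum_eval g"
  by (simp add: psum_eval_def eval_ipoly_add[OF coeff_hom_mconst])

lemma inj_psum_eval: "inj psum_eval"
proof (rule injI)
  fix f g
  assume "psum_eval f = psum_eval g"
  then have "psum_eval (f - g) = 0"
    using psum_eval_add[of "f - g" g] by simp
  then show "f = g"
    using psum_eval_eq_0 by fastforce
qed

section \<open>Spanning by power sum products\<close>

lemma finite_partitions_of: "finite (partitions_of n)"
proof (rule finite_subset)
  \<comment> \<open>Positive parts with sum \<open>n\<close> are at most \<open>n\<close> in size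
    and in number.\<close>
  show "partitions_of n \<subseteq> mset ` {xs. set xs \<subseteq> {..n} \<and> length xs \<le> n}"
  proof
    fix la
    assume la: "la \<in> partitions_of n"
    then have "\<forall>r\<in>#la. r \<le> n"
      unfolding partitions_of_def by (auto dest!: multi_member_split)
    moreover have "size la \<le> sum_mset la" if "0 \<notin># la"
      using that by (induction la) auto
    moreover obtain xs where "mset xs = la"
      using ex_mset by blast
    ultimately show "la \<in> mset ` {xs. set xs \<subseteq> {..n} \<and> length xs \<le> n}"
      using la by (intro image_eqI[of _ _ xs]) (auto simp: partitions_of_def)
  qed
qed (simp add: finite_lists_length_le)

text \<open>Subtraction truncates, so a part \<open>0\<close> would come back as
  \<open>1\<close>.\<close>

lemma image_mset_Suc_pred: "0 \<notin># la \<Longrightarrow> image_mset Suc (image_mset (\<lambda>r. r - 1) la) = la"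
  by (induction la) auto

lemma psum_eval_single_pred:
  assumes "0 \<notin># la"
  shows "psum_eval (Poly_Mapping.single (image_mset (\<lambda>r. r - 1) la) c) = mconst c * power_sum_prod la"
  unfolding psum_eval_single by (subst image_mset_Suc_pred[OF assms]) (rule refl)

text \<open>The induction eliminates the monomials with the largest number of variables: there,
  \<open>power_sum_prod la\<close> is a nonzero multiple of the monomial symmetric series of type \<open>la\<close>.\<close>

lemma psum_eval_spanning:
  assumes "symmetric_series F" "finite D"
    and "\<And>m. mcoeff F m \<noteq> 0 \<Longrightarrow> mdeg m \<in> D \<and> card (Poly_Mapping.keys m) < k"
  shows "\<exists>f. psum_eval f = F \<and> (\<forall>\<nu>\<in>Poly_Mapping.keys f. sum_mset (image_mset Suc \<nu>) \<in> D)"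
  using assms(1,3)
proof (induction k arbitrary: F)
  case 0
  \<comment> \<open>No monomial has fewer than 0 variables.\<close>
  then have "F = 0"
    by (intro mseries_eqI) (auto simp: zero_mseries.rep_eq)
  then have "psum_eval 0 = F"
    by (simp add: psum_eval_def)
  then show ?case
    by (intro exI[of _ 0]) simp
next
  case (Suc k)
  \<comment> \<open>The exponent types with \<open>k\<close> parts, the most that the bound
    \<open>Suc k\<close> allows.\<close>
  define L where "L = {la. 0 \<notin># la \<and> sum_mset la \<in> D \<and> size la = k}"
  have "finite L"
    by (rule finite_subset[of _ "\<Union>n\<in>D. partitions_of n"])
      (use assms(2) finite_partitions_of in \<open>auto simp: L_def partitions_of_def\<close>)
  have "\<forall>la. \<exists>m. 0 \<notin># la \<longrightarrow> exponents m = la"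
    using exponents_surj by metis
  then obtain rep where rep: "\<And>la. 0 \<notin># la \<Longrightarrow> exponents (rep la) = la"
    by metis
  \<comment> \<open>At \<open>rep la\<close> the only contribution to \<open>?S\<close> comes from
    \<open>la\<close>, so this quotient makes \<open>?S\<close> agree with \<open>F\<close> there;
    by symmetry they then agree at all monomials of type \<open>la\<close>.\<close>
  define c where "c la = mcoeff F (rep la) / mcoeff (power_sum_prod la) (rep la)" for la
  let ?S = "\<Sum>la\<in>L. mconst (c la) * power_sum_prod la"
  have coeff_S: "mcoeff ?S m = (\<Sum>la\<in>L. c la * mcoeff (power_sum_prod la) m)" for m
    by (simp add: mcoeff_sum mcoeff_mconst_mult)
  have sym_S: "symmetric_series ?S"
  proof -
    have "symmetric_series (power_sum_prod la)" for la
      using power_sum_prod_in_Lambda[of la] by (simp add: Lambda_def)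
    then show ?thesis
      by (intro symmetric_series_sum symmetric_series_mult symmetric_series_mconst)
  qed
  have "mdeg m \<in> D \<and> card (Poly_Mapping.keys m) < k" if nz: "mcoeff (F - ?S) m \<noteq> 0" for m
  proof -
    have S_nz: "mdeg m \<in> D \<and> card (Poly_Mapping.keys m) \<le> k" if S: "mcoeff ?S m \<noteq> 0"
    proof -
      obtain la where la: "la \<in> L" "mcoeff (power_sum_prod la) m \<noteq> 0"
        using S unfolding coeff_S by (auto elim!: sum.not_neutral_contains_not_neutral)
      have "mdeg m = sum_mset la"
        using power_sum_prod_in_Lambda[of la] la(2) by (simp add: Lambda_def)
      then show ?thesis
        using la mcoeff_power_sum_prod_triangular(1)[OF _ la(2)] by (auto simp: L_def)
    qed
    have "mcoeff F m \<noteq> 0 \<or> mcoeff ?S m \<noteq> 0"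
      using nz by (auto simp: minus_mseries.rep_eq)
    then have D: "mdeg m \<in> D" and le: "card (Poly_Mapping.keys m) \<le> k"
      using S_nz Suc.prems(2)[of m] by auto
    \<comment> \<open>At a monomial with exactly \<open>k\<close> variables \<open>F\<close> and
      \<open>?S\<close> agree, so the difference vanishes.\<close>
    have "card (Poly_Mapping.keys m) \<noteq> k"
    proof
      assume k: "card (Poly_Mapping.keys m) = k"
      let ?\<mu> = "exponents m"
      have \<mu>: "?\<mu> \<in> L"
        using zero_notin_exponents D k by (auto simp: L_def mdeg_exponents size_exponents)
      have e: "exponents (rep ?\<mu>) = ?\<mu>"
        by (rule rep) (rule zero_notin_exponents)
      have "mcoeff ?S m = (\<Sum>la\<in>{?\<mu>}. c la * mcoeff (power_sum_prod la) m)"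
        unfolding coeff_S
      proof (rule sum.mono_neutral_right)
        show "\<forall>la\<in>L - {?\<mu>}. c la * mcoeff (power_sum_prod la) m = 0"
          using mcoeff_power_sum_prod_triangular(2) k by (auto simp: L_def)
      qed (use \<open>finite L\<close> \<mu> in auto)
      also have "mcoeff (power_sum_prod ?\<mu>) m = mcoeff (power_sum_prod ?\<mu>) (rep ?\<mu>)"
        using power_sum_prod_in_Lambda[of ?\<mu>] e
        by (intro mcoeff_eq_if_exponents_eq) (simp_all add: Lambda_def)
      then have "(\<Sum>la\<in>{?\<mu>}. c la * mcoeff (power_sum_prod la) m) = mcoeff F (rep ?\<mu>)"
        using mcoeff_power_sum_prod_pos[of m] by (simp add: c_def)
      also have "\<dots> = mcoeff F m"
        using Suc.prems(1) e by (intro mcoeff_eq_if_exponents_eq) simp_all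
      finally show False
        using nz by (simp add: minus_mseries.rep_eq)
    qed
    with D le show ?thesis by simp
  qed
  then obtain f where f: "psum_eval f = F - ?S"
    "\<forall>\<nu>\<in>Poly_Mapping.keys f. sum_mset (image_mset Suc \<nu>) \<in> D"
    using Suc.IH[OF symmetric_series_diff[OF Suc.prems(1) sym_S]] by blast
  \<comment> \<open>Parts are lowered by one to become indices of indeterminates.\<close>
  let ?g = "\<Sum>la\<in>L. Poly_Mapping.single (image_mset (\<lambda>r. r - 1) la) (c la)"
  have "psum_eval ?g = (\<Sum>la\<in>L. psum_eval (Poly_Mapping.single (image_mset (\<lambda>r. r - 1) la) (c la)))"
    unfolding psum_eval_def by (rule eval_ipoly_sum[OF coeff_hom_mconst])
  also have "\<dots> = ?S"
    by (intro sum.cong refl psum_eval_single_pred) (simp add: L_def)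
  finally have "psum_eval (f + ?g) = F"
    by (simp add: psum_eval_add f(1))
  moreover have "sum_mset (image_mset Suc \<nu>) \<in> D" if "\<nu> \<in> Poly_Mapping.keys (f + ?g)" for \<nu>
  proof -
    have "\<nu> \<in> Poly_Mapping.keys f \<or> \<nu> \<in> Poly_Mapping.keys ?g"
      using that keys_add[of f ?g] by blast
    then show ?thesis
    proof
      assume "\<nu> \<in> Poly_Mapping.keys ?g"
      then have "\<nu> \<in> (\<Union>la\<in>L. Poly_Mapping.keys (Poly_Mapping.single (image_mset (\<lambda>r. r - 1) la) (c la)))"
        by (rule subsetD[OF keys_sum])
      then obtain la where "la \<in> L" "\<nu> = image_mset (\<lambda>r. r - 1) la"
        by (auto split: if_splits)
      then show ?thesis
        using image_mset_Suc_pred[of la] by (simp add: L_def)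
    qed (use f in blast)
  qed
  ultimately show ?case by blast
qed

lemma card_keys_le_mdeg: "card (Poly_Mapping.keys m) \<le> mdeg m"
proof -
  have "(\<Sum>i\<in>Poly_Mapping.keys m. 1) \<le> mdeg m"
    unfolding mdeg_def by (rule sum_mono) (simp add: in_keys_iff Suc_le_eq)
  then show ?thesis by simp
qed

lemma Lambda_psum_eval:
  assumes "F \<in> Lambda n"
  obtains f where "psum_eval f = F" "\<And>\<nu>. \<nu> \<in> Poly_Mapping.keys f \<Longrightarrow> sum_mset (image_mset Suc \<nu>) = n"
proof -
  \<comment> \<open>Every variable of a monomial contributes at least 1 to its degree, so
    \<open>Suc n\<close> strictly bounds the number of variables.\<close>
  have "\<exists>f. psum_eval f = F \<and> (\<forall>\<nu>\<in>Poly_Mapping.keys f. sum_mset (image_mset Suc \<nu>) \<in> {n})"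
  proof (rule psum_eval_spanning)
    show "symmetric_series F"
      using assms by (simp add: Lambda_def)
    show "mdeg m \<in> {n} \<and> card (Poly_Mapping.keys m) < Suc n" if "mcoeff F m \<noteq> 0" for m
      using assms that card_keys_le_mdeg[of m] by (auto simp: Lambda_def)
  qed simp
  with that show thesis by auto
qed

lemma Lambda_bounded_psum_eval:
  assumes "F \<in> Lambda_bounded"
  obtains f where "psum_eval f = F"
proof -
  obtain d where d: "\<And>m. mcoeff F m \<noteq> 0 \<Longrightarrow> mdeg m \<le> d"
    using assms unfolding Lambda_bounded_def by auto
  have "\<exists>f. psum_eval f = F \<and> (\<forall>\<nu>\<in>Poly_Mapping.keys f. sum_mset (image_mset Suc \<nu>) \<in> {..d})"
  proof (rule psum_eval_spanning)
    show "symmetric_series F"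
      using assms by (simp add: Lambda_bounded_def)
    show "mdeg m \<in> {..d} \<and> card (Poly_Mapping.keys m) < Suc d" if "mcoeff F m \<noteq> 0" for m
      using d[OF that] card_keys_le_mdeg[of m] by simp
  qed simp
  with that show thesis by auto
qed

section \<open>The substitution of powers\<close>

text \<open>The action of replacing each variable by its \<open>r\<close>-th power on exponent
  vectors.\<close>

abbreviation scale :: "nat \<Rightarrow> monomial \<Rightarrow> monomial" where
  "scale r \<equiv> Poly_Mapping.map ((*) r)"

lemma lookup_scale: "Poly_Mapping.lookup (scale r m) i = r * Poly_Mapping.lookup m i"
  by (simp add: map.rep_eq when_def)

lemma scale_add: "scale r (a + b) = scale r a + scale r b"
  by (rule poly_mapping_eqI) (simp add: lookup_scale lookup_add distrib_left)

lemma scale_single: "scale r (Poly_Mapping.single i s) = Poly_Mapping.single i (r * s)"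
  by (rule poly_mapping_eqI) (simp add: lookup_scale lookup_single when_def)

lemma scale_0: "scale r 0 = 0"
  by (rule poly_mapping_eqI) (simp add: lookup_scale)

lemma inj_scale:
  assumes "r \<ge> 1"
  shows "inj (scale r)"
proof (rule injI)
  fix a b
  assume "scale r a = scale r b"
  then have "r * Poly_Mapping.lookup a i = r * Poly_Mapping.lookup b i" for i
    by (metis lookup_scale)
  then show "a = b"
    using assms by (intro poly_mapping_eqI) simp
qed

lemma mcoeff_subst_power_scale:
  assumes "r \<ge> 1"
  shows "mcoeff (subst_power r G) (scale r m) = mcoeff G m"
proof -
  have "{m'. scale r m' = scale r m} = {m}"
    using inj_eq[OF inj_scale[OF assms]] by auto
  then show ?thesis
    by (simp add: subst_power.rep_eq)
qed

lemma mcoeff_subst_power_eq_0: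
  assumes "m \<notin> range (scale r)"
  shows "mcoeff (subst_power r G) m = 0"
proof -
  have "{m'. scale r m' = m} = {}"
    using assms by auto
  then show ?thesis
    by (simp add: subst_power.rep_eq)
qed

text \<open>As \<open>scale r\<close> is injective, the sum in \<open>subst_power\<close> has at
  most one term; comparing coefficients on and off the range of \<open>scale r\<close> replaces any
  handling of that sum.\<close>

lemma subst_power_eqI:
  assumes "r \<ge> 1" "\<And>m. mcoeff F (scale r m) = mcoeff G m"
    "\<And>m. m \<notin> range (scale r) \<Longrightarrow> mcoeff F m = 0"
  shows "subst_power r G = F"
proof (rule mseries_eqI)
  fix m
  show "mcoeff (subst_power r G) m = mcoeff F m"
    using assms by (cases "m \<in> range (scale r)")
      (auto simp: mcoeff_subst_power_scale mcoeff_subst_power_eq_0)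
qed

lemma subst_power_add:
  assumes "r \<ge> 1"
  shows "subst_power r (F + G) = subst_power r F + subst_power r G"
  by (rule subst_power_eqI[OF assms])
    (simp_all add: plus_mseries.rep_eq mcoeff_subst_power_scale[OF assms] mcoeff_subst_power_eq_0)

text \<open>Splittings of \<open>scale r m\<close> into two scaled monomials are the scaled
  splittings of \<open>m\<close>; in any other splitting one factor has coefficient 0.\<close>

lemma subst_power_mult:
  assumes "r \<ge> 1"
  shows "subst_power r (F * G) = subst_power r F * subst_power r G"
proof (rule subst_power_eqI[OF assms])
  fix m
  note inj = inj_scale[OF assms]
  let ?f = "map_prod (scale r) (scale r)"
  have "mcoeff (subst_power r F * subst_power r G) (scale r m)
    = (\<Sum>(a, b)\<in>?f ` {(a, b). a + b = m}. mcoeff (subst_power r F) a * mcoeff (subst_power r G) b)"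
    unfolding times_mseries.rep_eq
  proof (rule sum.mono_neutral_right[OF finite_monomial_splits])
    show "?f ` {(a, b). a + b = m} \<subseteq> {(a, b). a + b = scale r m}"
      by (auto simp: scale_add)
    show "\<forall>x\<in>{(a, b). a + b = scale r m} - ?f ` {(a, b). a + b = m}.
        (case x of (a, b) \<Rightarrow> mcoeff (subst_power r F) a * mcoeff (subst_power r G) b) = 0"
    proof clarify
      fix a b
      assume ab: "a + b = scale r m" "(a, b) \<notin> ?f ` {(a, b). a + b = m}"
      have False if "a = scale r a'" "b = scale r b'" for a' b'
      proof -
        have "a' + b' = m"
          using ab(1) that injD[OF inj, of "a' + b'" m] by (simp add: scale_add)
        then have "(a, b) = ?f (a', b')" "(a', b') \<in> {(a, b). a + b = m}"
          using that by auto
        with ab(2) show False by blast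
      qed
      then have "a \<notin> range (scale r) \<or> b \<notin> range (scale r)"
        by blast
      then show "mcoeff (subst_power r F) a * mcoeff (subst_power r G) b = 0"
        by (auto simp: mcoeff_subst_power_eq_0)
    qed
  qed
  also have "\<dots> = mcoeff (F * G) m"
    unfolding times_mseries.rep_eq
    by (subst sum.reindex)
      (auto intro!: inj_on_subset[OF prod.inj_map[OF inj inj]] sum.cong
        simp: mcoeff_subst_power_scale[OF assms])
  finally show "mcoeff (subst_power r F * subst_power r G) (scale r m) = mcoeff (F * G) m" .
next
  fix m
  assume m: "m \<notin> range (scale r)"
  show "mcoeff (subst_power r F * subst_power r G) m = 0"
  proof (rule ccontr)
    assume "mcoeff (subst_power r F * subst_power r G) m \<noteq> 0"
    then obtain a b where ab: "a + b = m" "mcoeff (subst_power r F) a \<noteq> 0" "mcoeff (subst_power r G) b \<noteq> 0"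
      by (rule mcoeff_mult_nonzero)
    then obtain a' b' where "a = scale r a'" "b = scale r b'"
      by (metis mcoeff_subst_power_eq_0 imageE)
    then have "m = scale r (a' + b')"
      using ab(1) by (simp add: scale_add)
    with m show False by blast
  qed
qed

lemma subst_power_mconst:
  assumes "r \<ge> 1"
  shows "subst_power r (mconst c) = mconst c"
proof (rule subst_power_eqI[OF assms])
  show "mcoeff (mconst c) (scale r m) = mcoeff (mconst c) m" for m
    using injD[OF inj_scale[OF assms], of m 0] by (auto simp: mconst.rep_eq scale_0)
  show "mcoeff (mconst c) m = 0" if "m \<notin> range (scale r)" for m
    using that scale_0[of r] by (auto simp: mconst.rep_eq intro: rev_image_eqI)
qed

text \<open>Plethysm of two power sums: injectivity of \<open>scale r\<close> matches the
  \<open>s\<close>-th powers of variables with the \<open>r * s\<close>-th ones.\<close>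

lemma subst_power_power_sum:
  assumes "r \<ge> 1"
  shows "subst_power r (power_sum s) = power_sum (r * s)"
proof (rule subst_power_eqI[OF assms])
  fix m
  have "(\<exists>i. scale r m = Poly_Mapping.single i (r * s)) \<longleftrightarrow> (\<exists>i. m = Poly_Mapping.single i s)"
    using injD[OF inj_scale[OF assms]] by (metis scale_single)
  then show "mcoeff (power_sum (r * s)) (scale r m) = mcoeff (power_sum s) m"
    by (simp add: power_sum.rep_eq)
next
  fix m
  assume "m \<notin> range (scale r)"
  then have "m \<noteq> Poly_Mapping.single i (r * s)" for i
    by (metis scale_single rangeI)
  then show "mcoeff (power_sum (r * s)) m = 0"
    by (simp add: power_sum.rep_eq)
qed

lemma mdeg_scale:
  assumes "r \<ge> 1"
  shows "mdeg (scale r m) = r * mdeg m"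
proof -
  have "Poly_Mapping.keys (scale r m) = Poly_Mapping.keys m"
    using assms by (auto simp: in_keys_iff lookup_scale)
  then show ?thesis
    by (simp add: mdeg_def lookup_scale sum_distrib_left)
qed

lemma subst_power_in_Lambda:
  assumes "r \<ge> 1" "G \<in> Lambda n"
  shows "subst_power r G \<in> Lambda (r * n)"
proof -
  have "symmetric_series (subst_power r G)"
    unfolding symmetric_series_def
  proof (intro allI impI)
    fix \<pi> :: "nat \<Rightarrow> nat" and m :: monomial
    assume \<pi>: "bij \<pi>"
    \<comment> \<open>Renaming variables commutes with scaling exponents.\<close>
    note key_scale = map_key_map[OF bij_is_inj[OF \<pi>]]
    show "mcoeff (subst_power r G) (Poly_Mapping.map_key \<pi> m) = mcoeff (subst_power r G) m"
    proof (cases "m \<in> range (scale r)")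
      case True
      then obtain a where m: "m = scale r a"
        by blast
      have "mcoeff G (Poly_Mapping.map_key \<pi> a) = mcoeff G a"
        using assms(2) \<pi> by (simp add: Lambda_def symmetric_series_def)
      then show ?thesis
        unfolding m key_scale by (simp only: mcoeff_subst_power_scale[OF assms(1)])
    next
      case False
      have "Poly_Mapping.map_key \<pi> m \<notin> range (scale r)"
      proof
        assume "Poly_Mapping.map_key \<pi> m \<in> range (scale r)"
        then obtain a where "Poly_Mapping.map_key \<pi> m = scale r a"
          by blast
        then have "m = Poly_Mapping.map_key (inv \<pi>) (scale r a)"
          using map_key_inv(2)[OF \<pi>, of m] by simp
        then have "m = scale r (Poly_Mapping.map_key (inv \<pi>) a)"
          using map_key_map[OF bij_is_inj[OF bij_imp_bij_inv[OF \<pi>]]] by simp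
        with False show False by blast
      qed
      with False show ?thesis
        by (simp add: mcoeff_subst_power_eq_0)
    qed
  qed
  moreover have "mdeg m = r * n" if "mcoeff (subst_power r G) m \<noteq> 0" for m
  proof -
    have "m \<in> range (scale r)"
      using that mcoeff_subst_power_eq_0[of m r G] by blast
    then obtain a where "m = scale r a"
      by blast
    then show ?thesis
      using that assms by (simp add: mcoeff_subst_power_scale mdeg_scale Lambda_def)
  qed
  ultimately show ?thesis
    by (simp add: Lambda_def)
qed

section \<open>Plethysm and characteristic polynomials in power sum coordinates\<close>

lemma psum_eval_const: "psum_eval (Poly_Mapping.single 0 c) = mconst c"
  by (simp add: psum_eval_def eval_ipoly_single[OF coeff_hom_mconst])

lemma psum_eval_indeterminate: "psum_eval (Poly_Mapping.single {#r#} 1) = power_sum (Suc r)"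
  by (simp add: psum_eval_def eval_ipoly_single[OF coeff_hom_mconst] coeff_hom_simps(2)[OF coeff_hom_mconst])

lemma psum_eval_mult: "psum_eval (f * g) = psum_eval f * psum_eval g"
  by (simp add: psum_eval_def eval_ipoly_mult[OF coeff_hom_mconst])

text \<open>Resolves the definite description in \<open>plethysm\<close>. Existence comes from
  carrying the substitution over along the injection \<open>psum_eval\<close>, uniqueness from
  \<open>hom_eval_ipoly\<close>.\<close>

lemma plethysm_psum_eval:
  "plethysm (psum_eval f) G = eval_ipoly mconst (\<lambda>r. subst_power (Suc r) G) f"
proof -
  define E where "E = eval_ipoly mconst (\<lambda>r. subst_power (Suc r) G)"
  \<comment> \<open>The value off the range of \<open>psum_eval\<close> is arbitrary;
    \<open>plethysm_hom\<close> constrains \<open>\<phi>\<close> only at constants, power sums and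
    members of \<open>Lambda_bounded\<close>, all within the range.\<close>
  define \<phi> where "\<phi> F = E (inv psum_eval F)" for F
  have \<phi>: "\<phi> (psum_eval f) = E f" for f
    by (simp add: \<phi>_def inv_f_f[OF inj_psum_eval])
  have "plethysm_hom G \<phi>"
    unfolding plethysm_hom_def
  proof (intro conjI allI impI ballI)
    fix r :: nat
    assume "r \<ge> 1"
    then have "power_sum r = psum_eval (Poly_Mapping.single {#r - 1#} 1)"
      by (simp add: psum_eval_indeterminate)
    then show "\<phi> (power_sum r) = subst_power r G"
      using \<open>r \<ge> 1\<close>
      by (simp add: \<phi> E_def eval_ipoly_single[OF coeff_hom_mconst] coeff_hom_simps(2)[OF coeff_hom_mconst])
  next
    show "\<phi> (mconst c) = mconst c" for c
      by (simp add: psum_eval_const[symmetric] \<phi>)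
        (simp add: psum_eval_const E_def eval_ipoly_single[OF coeff_hom_mconst])
  next
    fix F H
    assume "F \<in> Lambda_bounded" "H \<in> Lambda_bounded"
    then obtain f h where "F = psum_eval f" "H = psum_eval h"
      by (metis Lambda_bounded_psum_eval)
    then show "\<phi> (F + H) = \<phi> F + \<phi> H" "\<phi> (F * H) = \<phi> F * \<phi> H"
      by (simp_all add: psum_eval_add[symmetric] psum_eval_mult[symmetric] \<phi>)
        (simp_all add: E_def eval_ipoly_add[OF coeff_hom_mconst] eval_ipoly_mult[OF coeff_hom_mconst])
  qed
  moreover have "\<psi> (psum_eval f) = E f" if "plethysm_hom G \<psi>" for \<psi>
  proof -
    have "\<psi> (psum_eval f) = eval_ipoly mconst (\<lambda>r. \<psi> (power_sum (Suc r))) f"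
      unfolding psum_eval_def
    proof (rule hom_eval_ipoly[where S = Lambda_bounded])
      show "power_sum (Suc r) \<in> Lambda_bounded" for r
        using Lambda_subset_bounded power_sum_in_Lambda by blast
      show "mconst c \<in> Lambda_bounded" for c
        using Lambda_subset_bounded mconst_in_Lambda by blast
    qed (use that in \<open>simp_all add: plethysm_hom_def Lambda_bounded_add_mult coeff_hom_mconst\<close>)
    then show ?thesis
      using that by (simp add: plethysm_hom_def E_def)
  qed
  ultimately show ?thesis
    unfolding plethysm_def E_def[symmetric] using \<phi>
    by (intro the_equality) metis+
qed

text \<open>The characteristic polynomial in coordinates: all indeterminates become the same
  variable, so only the number of factors of a term is remembered.\<close>

definition char_eval :: "ipoly \<Rightarrow> rat poly" where
  "char_eval = eval_ipoly (\<lambda>c. [:c:]) (\<lambda>_. [:0, 1:])"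

lemma char_eval_single: "char_eval (Poly_Mapping.single \<nu> c) = monom c (size \<nu>)"
  by (simp add: char_eval_def eval_ipoly_single[OF coeff_hom_pCons] prod_mset_constant monom_altdef)

text \<open>With weight \<open>Suc r\<close> for the indeterminate \<open>r\<close>, a homogeneous
  \<open>f\<close> is brought into the form over partitions in which \<open>char_polynomial\<close>
  is stated.\<close>

lemma ipoly_eq_sum_partitions:
  assumes "\<And>\<nu>. \<nu> \<in> Poly_Mapping.keys f \<Longrightarrow> sum_mset (image_mset Suc \<nu>) = n"
  shows "f = (\<Sum>la\<in>partitions_of n.
    Poly_Mapping.single (image_mset (\<lambda>r. r - 1) la) (Poly_Mapping.lookup f (image_mset (\<lambda>r. r - 1) la)))"
    (is "f = ?S")
proof (rule poly_mapping_eqI)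
  fix \<nu>
  have pred: "image_mset (\<lambda>r. r - 1) la = \<nu> \<longleftrightarrow> la = image_mset Suc \<nu>" if "la \<in> partitions_of n" for la
    using that image_mset_Suc_pred[of la]
    by (auto simp: partitions_of_def image_mset.compositionality comp_def)
  have "Poly_Mapping.lookup ?S \<nu>
      = (\<Sum>la\<in>partitions_of n. if la = image_mset Suc \<nu> then Poly_Mapping.lookup f \<nu> else 0)"
    unfolding lookup_sum by (rule sum.cong) (auto simp: lookup_single when_def dest: pred)
  also have "\<dots> = Poly_Mapping.lookup f \<nu>"
  proof (cases "\<nu> \<in> Poly_Mapping.keys f")
    case True
    then have "image_mset Suc \<nu> \<in> partitions_of n"
      using assms by (auto simp: partitions_of_def)
    then show ?thesis
      by (simp add: finite_partitions_of)
  qed (simp add: in_keys_iff finite_partitions_of)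
  finally show "Poly_Mapping.lookup f \<nu> = Poly_Mapping.lookup ?S \<nu>" by simp
qed

text \<open>By injectivity of \<open>psum_eval\<close>, any expansion in power sum products,
  whatever its \<open>n\<close> and \<open>c\<close>, comes from \<open>f\<close> itself; hence the
  described polynomial exists and is unique.\<close>

lemma char_polynomial_psum_eval:
  assumes "psum_eval f \<in> Lambda n"
  shows "char_polynomial (psum_eval f) = char_eval f"
proof -
  let ?sum = "\<lambda>n c. \<Sum>la\<in>partitions_of n. Poly_Mapping.single (image_mset (\<lambda>r. r - 1) la) (c la)"
  have psum: "psum_eval (?sum n c) = (\<Sum>la\<in>partitions_of n. mconst (c la) * power_sum_prod la)" for n c
  proof -
    have "psum_eval (?sum n c)
        = (\<Sum>la\<in>partitions_of n. psum_eval (Poly_Mapping.single (image_mset (\<lambda>r. r - 1) la) (c la)))"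
      unfolding psum_eval_def by (rule eval_ipoly_sum[OF coeff_hom_mconst])
    also have "\<dots> = (\<Sum>la\<in>partitions_of n. mconst (c la) * power_sum_prod la)"
      by (intro sum.cong refl psum_eval_single_pred) (simp add: partitions_of_def)
    finally show ?thesis .
  qed
  have char: "char_eval (?sum n c) = (\<Sum>la\<in>partitions_of n. monom (c la) (size la))" for n c
  proof -
    have "char_eval (?sum n c)
        = (\<Sum>la\<in>partitions_of n. char_eval (Poly_Mapping.single (image_mset (\<lambda>r. r - 1) la) (c la)))"
      unfolding char_eval_def by (rule eval_ipoly_sum[OF coeff_hom_pCons])
    then show ?thesis
      by (simp add: char_eval_single)
  qed
  \<comment> \<open>A homogeneous preimage exists, and injectivity identifies it with
    \<open>f\<close>, so \<open>f\<close> is itself homogeneous.\<close>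
  obtain f' where f': "psum_eval f' = psum_eval f"
    "\<And>\<nu>. \<nu> \<in> Poly_Mapping.keys f' \<Longrightarrow> sum_mset (image_mset Suc \<nu>) = n"
    using Lambda_psum_eval[OF assms] by blast
  then have "f' = f"
    using injD[OF inj_psum_eval] by blast
  then obtain c where c: "f = ?sum n c"
    using ipoly_eq_sum_partitions[of f n] f'(2) by metis
  show ?thesis
    unfolding char_polynomial_def
  proof (rule the_equality)
    have "psum_eval f = (\<Sum>la\<in>partitions_of n. mconst (c la) * power_sum_prod la)"
      "char_eval f = (\<Sum>la\<in>partitions_of n. monom (c la) (size la))"
      unfolding c psum char by (rule refl)+
    with assms show "\<exists>n c. psum_eval f \<in> Lambda n \<and>
      psum_eval f = (\<Sum>la\<in>partitions_of n. mconst (c la) * power_sum_prod la) \<and>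
      char_eval f = (\<Sum>la\<in>partitions_of n. monom (c la) (size la))"
      by blast
  next
    fix P
    assume "\<exists>n c. psum_eval f \<in> Lambda n \<and>
      psum_eval f = (\<Sum>la\<in>partitions_of n. mconst (c la) * power_sum_prod la) \<and>
      P = (\<Sum>la\<in>partitions_of n. monom (c la) (size la))"
    then obtain n c where "psum_eval f = psum_eval (?sum n c)" "P = char_eval (?sum n c)"
      unfolding psum char by blast
    then show "P = char_eval f"
      using injD[OF inj_psum_eval] by metis
  qed
qed

text \<open>\<open>subst_power (Suc r)\<close> in coordinates. It takes
  \<open>power_sum (Suc s)\<close> to \<open>power_sum (Suc r * Suc s)\<close>, whose index is one
  less than the product.\<close>

definition power_subst_ipoly :: "nat \<Rightarrow> ipoly \<Rightarrow> ipoly" where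
  "power_subst_ipoly r =
     eval_ipoly (Poly_Mapping.single 0) (\<lambda>s. Poly_Mapping.single {#Suc r * Suc s - 1#} 1)"

lemma subst_power_psum_eval:
  "subst_power (Suc r) (psum_eval g) = psum_eval (power_subst_ipoly r g)"
proof -
  have "subst_power (Suc r) (psum_eval g)
      = eval_ipoly mconst (\<lambda>s. subst_power (Suc r) (power_sum (Suc s))) g"
    unfolding psum_eval_def
    by (rule hom_eval_ipoly[where S = UNIV])
      (simp_all add: coeff_hom_mconst subst_power_mconst subst_power_add subst_power_mult)
  also have "\<dots> = eval_ipoly mconst (\<lambda>s. psum_eval (Poly_Mapping.single {#Suc r * Suc s - 1#} 1)) g"
    by (simp add: subst_power_power_sum psum_eval_indeterminate)
  also have "\<dots> = psum_eval (power_subst_ipoly r g)"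
    unfolding power_subst_ipoly_def
    by (rule hom_eval_ipoly[where S = UNIV, symmetric])
      (simp_all add: coeff_hom_mconst coeff_hom_single psum_eval_const psum_eval_add psum_eval_mult)
  finally show ?thesis .
qed

lemma char_eval_eval_ipoly:
  "char_eval (eval_ipoly (Poly_Mapping.single 0) h f) = eval_ipoly (\<lambda>c. [:c:]) (\<lambda>r. char_eval (h r)) f"
proof (rule hom_eval_ipoly[where S = UNIV])
  show "char_eval (Poly_Mapping.single 0 c) = [:c:]" for c
    by (simp add: char_eval_single monom_0)
qed (simp_all add: coeff_hom_single coeff_hom_pCons char_eval_def
    eval_ipoly_add[OF coeff_hom_pCons] eval_ipoly_mult[OF coeff_hom_pCons])

text \<open>Indeterminates go to indeterminates, and \<open>char_eval\<close> does not tell them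
  apart.\<close>

lemma char_eval_power_subst_ipoly: "char_eval (power_subst_ipoly r g) = char_eval g"
  unfolding power_subst_ipoly_def char_eval_eval_ipoly
  by (simp add: char_eval_single) (simp add: char_eval_def monom_altdef)

text \<open>Composition with a fixed inner polynomial is a ring homomorphism, so it passes through
  the substitution.\<close>

lemma pcompose_char_eval: "pcompose (char_eval f) q = eval_ipoly (\<lambda>c. [:c:]) (\<lambda>_. q) f"
proof -
  have "pcompose (char_eval f) q = eval_ipoly (\<lambda>c. [:c:]) (\<lambda>_. pcompose [:0, 1:] q) f"
    unfolding char_eval_def
    by (rule hom_eval_ipoly[where S = UNIV and \<theta> = "\<lambda>p. pcompose p q"])
      (simp_all add: coeff_hom_pCons pcompose_add pcompose_mult)
  then show ?thesis
    by (simp add: pcompose_pCons)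
qed

text \<open>Supplies the homogeneity that \<open>char_polynomial_psum_eval\<close> demands: each
  \<open>subst_power r G\<close> has degree \<open>r * n'\<close>, and the indices \<open>r\<close>
  in a term of \<open>F\<close> add up to \<open>n\<close>.\<close>

lemma plethysm_in_Lambda:
  assumes "F \<in> Lambda n" "G \<in> Lambda n'"
  shows "plethysm F G \<in> Lambda (n * n')"
proof -
  obtain f where f: "psum_eval f = F"
    "\<And>\<nu>. \<nu> \<in> Poly_Mapping.keys f \<Longrightarrow> sum_mset (image_mset Suc \<nu>) = n"
    using assms(1) by (rule Lambda_psum_eval) blast
  have "mconst c * (\<Prod>r\<in>#\<nu>. subst_power (Suc r) G) \<in> Lambda (n * n')"
    if "\<nu> \<in> Poly_Mapping.keys f" for \<nu> c
  proof -
    have "(\<Prod>r\<in>#\<nu>. subst_power (Suc r) G) \<in> Lambda (\<Sum>r\<in>#\<nu>. Suc r * n')"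
      by (rule prod_mset_in_Lambda) (rule subst_power_in_Lambda[OF _ assms(2)], simp)
    also have "(\<Sum>r\<in>#\<nu>. Suc r * n') = n * n'"
      using f(2)[OF that] by (metis sum_mset_distrib_right)
    finally show ?thesis
      using mult_in_Lambda[OF mconst_in_Lambda] by fastforce
  qed
  then show ?thesis
    unfolding f(1)[symmetric] plethysm_psum_eval eval_ipoly_def by (intro sum_in_Lambda)
qed

theorem proposition3p2:
  fixes n n' :: nat and F G :: mseries
  assumes "F \<in> Lambda n" and "G \<in> Lambda n'"
  shows "char_polynomial (plethysm F G) = pcompose (char_polynomial F) (char_polynomial G)"
proof -
  obtain f g where f: "F = psum_eval f" and g: "G = psum_eval g"
    using assms by (metis Lambda_psum_eval)
  \<comment> \<open>The coordinates of the plethysm: substitution inside \<open>ipoly\<close>,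
    before passing to series.\<close>
  let ?h = "eval_ipoly (Poly_Mapping.single 0) (\<lambda>r. power_subst_ipoly r g) f"
  have "plethysm F G = eval_ipoly mconst (\<lambda>r. psum_eval (power_subst_ipoly r g)) f"
    by (simp add: f g plethysm_psum_eval subst_power_psum_eval)
  also have "\<dots> = psum_eval ?h"
    by (rule hom_eval_ipoly[where S = UNIV, symmetric])
      (simp_all add: coeff_hom_mconst coeff_hom_single psum_eval_const psum_eval_add psum_eval_mult)
  finally have pleth: "plethysm F G = psum_eval ?h" .
  then have "char_polynomial (plethysm F G) = char_eval ?h"
    using plethysm_in_Lambda[OF assms] char_polynomial_psum_eval by simp
  \<comment> \<open>The substituted value no longer depends on \<open>r\<close>, which turns the
    substitution into a composition of univariate polynomials.\<close>
  also have "\<dots> = eval_ipoly (\<lambda>c. [:c:]) (\<lambda>_. char_eval g) f"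
    by (simp add: char_eval_eval_ipoly char_eval_power_subst_ipoly)
  also have "\<dots> = pcompose (char_polynomial F) (char_polynomial G)"
    using assms char_polynomial_psum_eval by (simp add: pcompose_char_eval f g)
  finally show ?thesis .
qed

end
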